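(* Let $m\ge 1$, let $S\subset \Pi_m$ be a set of set partition patterns, and let $n\ge m$ and $k\ge 1$ be integers. Then $$\delta_r(S,n,k)=\hat{\delta}(S,n,k).$$
   Context: Let $[n]=\{1,\dots,n\}$. A partition of $[n]$ into disjoint nonempty blocks $B_1/B_2/\cdots/B_t$, ordered so that $\min B_1<\min B_2<\cdots<\min B_t$, is identified with the word $\pi_1\pi_2\cdots\pi_n$ where $\pi_i=j$ iff $i\in B_j$. The words so obtained are exactly the canonized words, i.e. those in which the distinct letters are $1,2,\dots,t$ for some $t$ and their first occurrences appear in the order $1,2,\dots,t$. $\Pi_n$ is the set of all partitions of $[n]$ (as words) and $\Pi_{n,k}$ is the set of partitions of $[n]$ with at most $k$ blocks. $[k]^n$ is the set of all words of length $n$ over the alphabet $[k]$. Two words $u=u_1\cdots u_m$ and $w=w_1\cdots w_m$ are order isomorphic if for all $i\neq j$: $u_i=u_j$ iff $w_i=w_j$, and $u_i<u_j$ iff $w_i<w_j$. For a partition (word) $\sigma$ of length $n$, $\nu_r(S,\sigma)$ is the number of copies of patterns of $S$ in $\sigma$ in the restricted sense, i.e. the number of choices of positions $i_1<\cdots<i_m$ such that $\sigma_{i_1}\cdots\sigma_{i_m}$ is order isomorphic to some element of $S$. For an arbitrary word $\sigma\in[k]^n$, $\hat\nu(S,\sigma)$ is the number of occurrences of patterns of $S$ in $\sigma$, defined in the same way (choices of positions whose subword is order isomorphic to an element of $S$). Define $$\delta_r(S,n,k)=\frac{\max\{\nu_r(S,\pi):\pi\in\Pi_{n,k}\}}{\binom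 nm},\qquad \hat\delta(S,n,k)=\frac{\max\{\hat\nu(S,\sigma):\sigma\in[k]^n\}}{\binom nm}.$$ *)

theory Defs
  imports Complex_Main "HOL-Library.Disjoint_Sets"
begin

text \<open>
  The list \<open>Bs\<close> is a partition of \<open>[n]\<close> written as \<open>B\<^sub>1/B\<^sub>2/\<dots>/B\<^sub>t\<close> with increasing block minima,
  and \<open>w\<close> is its word. Blocks, positions and letters are counted from 1 in the mathematics,
  whereas list entries are counted from 0, whence \<open>w ! (i - 1)\<close> for \<open>\<pi>\<^sub>i\<close> and
  \<open>Bs ! (j - 1)\<close> for \<open>B\<^sub>j\<close>. \<^const>\<open>partition_on\<close> includes nonemptiness of the blocks, and the
  strict order of the minima makes \<open>Bs\<close> distinct, so \<open>length Bs\<close> is the number of blocks.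
\<close>

definition word_of_partition :: "nat \<Rightarrow> nat set list \<Rightarrow> nat list \<Rightarrow> bool" where
  "word_of_partition n Bs w \<longleftrightarrow>
     partition_on {1..n} (set Bs) \<and>
     sorted_wrt (\<lambda>A B. Min A < Min B) Bs \<and>
     length w = n \<and>
     (\<forall>i\<in>{1..n}. \<forall>j. w ! (i - 1) = j \<longleftrightarrow> j \<in> {1..length Bs} \<and> i \<in> Bs ! (j - 1))"

definition set_partitions :: "nat \<Rightarrow> nat list set" where
  "set_partitions n = {w. \<exists>Bs. word_of_partition n Bs w}"

definition set_partitions_at_most :: "nat \<Rightarrow> nat \<Rightarrow> nat list set" where
  "set_partitions_at_most n k = {w. \<exists>Bs. word_of_partition n Bs w \<and> length Bs \<le> k}"

definition words :: "nat \<Rightarrow> nat \<Rightarrow> nat list set" where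
  "words k n = {w. set w \<subseteq> {1..k} \<and> length w = n}"

definition order_isomorphic :: "nat list \<Rightarrow> nat list \<Rightarrow> bool" where
  "order_isomorphic u w \<longleftrightarrow>
     length u = length w \<and>
     (\<forall>i<length u. \<forall>j<length u. i \<noteq> j \<longrightarrow>
        (u ! i = u ! j \<longleftrightarrow> w ! i = w ! j) \<and> (u ! i < u ! j \<longleftrightarrow> w ! i < w ! j))"

text \<open>
  A choice of positions is a set \<open>I\<close> of (0-based) indices, and \<open>nths w I\<close> is the subword at these
  positions. \<^const>\<open>order_isomorphic\<close> forces \<open>card I\<close> to be the length of the pattern. Since
  the counts \<open>\<nu>\<^sub>r\<close> for partitions and the hatted \<open>\<nu>\<close> for arbitrary words are given by the same
  formula, \<open>occurrences\<close> serves for both.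
\<close>

definition occurrences :: "nat list set \<Rightarrow> nat list \<Rightarrow> nat" where
  "occurrences S w =
     card {I. I \<subseteq> {..<length w} \<and> (\<exists>s\<in>S. order_isomorphic (nths w I) s)}"

text \<open>The pattern length \<open>m\<close>, implicit in \<open>S\<close> on paper, is an explicit argument.\<close>

definition delta_restricted :: "nat \<Rightarrow> nat list set \<Rightarrow> nat \<Rightarrow> nat \<Rightarrow> real" where
  "delta_restricted m S n k =
     real (Max (occurrences S ` set_partitions_at_most n k)) / real (n choose m)"

definition delta_hat :: "nat \<Rightarrow> nat list set \<Rightarrow> nat \<Rightarrow> nat \<Rightarrow> real" where
  "delta_hat m S n k =
     real (Max (occurrences S ` words k n)) / real (n choose m)"

end

theory Submission
  imports Defs
begin

text \<open>
  Partition words are words over \<open>[k]\<close>, so it suffices to find, among the words in \<open>[k]\<^sup>n\<close> with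
  the maximal number of occurrences, one that is the word of a partition. Canonizing a maximizer
  is not the way: relabelling the letters by order of first appearance can destroy occurrences
  (the word 212 contains the pattern 12, in its last two letters, and becomes 121, in which these
  two letters read 21). Instead, a maximizer \<open>w\<close> with the least sum of letters already is
  canonized.

  The argument is a symmetrization in the style of Zykov. Suppose that \<open>p < q\<close>, that \<open>q\<close> is the
  first position of its letter, and that \<open>w\<^sub>p > w\<^sub>q\<close>. In a canonized pattern every letter
  appears for the first time before all larger ones, so no occurrence uses both \<open>p\<close> and \<open>q\<close>
  (\<open>no_occurrence_contains_both\<close>). Let \<open>c\<^sub>0\<close>, \<open>c\<^sub>p\<close> and \<open>c\<^sub>q\<close> be the numbers of occurrences using
  neither, only \<open>p\<close>, and only \<open>q\<close>; the total is \<open>c\<^sub>0 + c\<^sub>p + c\<^sub>q\<close>. Deleting the letter at \<open>p\<close> and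
  doubling the letter at \<open>q\<close> yields a word with at least \<open>c\<^sub>0 + 2 c\<^sub>q\<close> occurrences, and with the
  roles exchanged at least \<open>c\<^sub>0 + 2 c\<^sub>p\<close> (\<open>occurrences_clone\<close>). Neither exceeds the maximum, hence
  \<open>c\<^sub>p = c\<^sub>q\<close>, and the first of the two words is again a maximizer. It has a smaller sum of
  letters, a contradiction (\<open>symmetrization\<close>).

  So in \<open>w\<close> the first occurrence of a letter is never preceded by a larger letter. Furthermore
  the letters of \<open>w\<close> fill an interval \<open>{1..t}\<close>, since closing a gap keeps all occurrences and
  decreases the sum (\<open>compress_gap\<close>). These two properties say that \<open>w\<close> is canonized.
\<close>

section \<open>Words of set partitions\<close>

text \<open>
  The defect to be removed is a pair \<open>p < q\<close> with a descent \<open>w ! p > w ! q\<close> such that \<open>q\<close> is a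
  first occurrence; the definition says that there is none. As \<open>r\<close> can be taken to be the first
  occurrence of the letter \<open>w ! q\<close>, this is the same as asking for \<open>r < p\<close>, that is, the first
  occurrences of the letters come in increasing order.
\<close>
definition first_occurrences_ordered :: "nat list \<Rightarrow> bool" where
  "first_occurrences_ordered w \<longleftrightarrow>
     (\<forall>p q. p < q \<longrightarrow> q < length w \<longrightarrow> w ! q < w ! p \<longrightarrow> (\<exists>r<q. w ! r = w ! q))"

lemma word_of_partition_letter:
  assumes "word_of_partition n Bs w" and "i < n"
  shows "w ! i = j \<longleftrightarrow> j \<in> {1..length Bs} \<and> Suc i \<in> Bs ! (j - 1)"
proof -
  have "Suc i \<in> {1..n}" using assms(2) by simp
  with assms(1) have "w ! (Suc i - 1) = j \<longleftrightarrow> j \<in> {1..length Bs} \<and> Suc i \<in> Bs ! (j - 1)"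
    unfolding word_of_partition_def by blast
  then show ?thesis by simp
qed

text \<open>
  A smaller letter names the block with the smaller minimum, and the minimum of a block is the
  first occurrence of its letter.
\<close>

lemma set_partitions_first_occurrences_ordered:
  assumes "w \<in> set_partitions n"
  shows "first_occurrences_ordered w"
  unfolding first_occurrences_ordered_def
proof (intro allI impI)
  fix p q assume pq: "p < q" "q < length w" "w ! q < w ! p"
  obtain Bs where w: "word_of_partition n Bs w"
    using assms by (auto simp: set_partitions_def)
  then have n: "length w = n" and srt: "sorted_wrt (\<lambda>A B. Min A < Min B) Bs"
    and part: "partition_on {1..n} (set Bs)"
    by (auto simp: word_of_partition_def)
  note letter = word_of_partition_letter[OF w]
  let ?A = "Bs ! (w ! q - 1)" and ?B = "Bs ! (w ! p - 1)"
  have q: "w ! q \<in> {1..length Bs}" "Suc q \<in> ?A"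
    using letter[of q] pq n by auto
  have p: "w ! p \<in> {1..length Bs}" "Suc p \<in> ?B"
    using letter[of p] pq n by auto
  have less: "Min ?A < Min ?B"
    using srt pq p q by (auto simp: sorted_wrt_iff_nth_less)
  have "?A \<in> set Bs" "?B \<in> set Bs" using p q by auto
  then have sub: "?A \<subseteq> {1..n}" "?B \<subseteq> {1..n}"
    using part by (auto simp: partition_on_def)
  then have fin: "finite ?A" "finite ?B" using finite_subset by blast+
  have "Min ?B \<le> Suc p" using fin p by simp
  with less pq have lt: "Min ?A < Suc q" by linarith
  have mem: "Min ?A \<in> ?A" using fin q(2) by (metis Min_in empty_iff)
  then have "Min ?A \<in> {1..n}" using sub by blast
  then obtain r where r: "Min ?A = Suc r" "r < n" by (cases "Min ?A") auto
  then have "w ! r = w ! q" using letter[of r "w ! q"] mem q by simp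
  then show "\<exists>r<q. w ! r = w ! q" using r lt by auto
qed

lemma set_partitions_at_most_subset_words: "set_partitions_at_most n k \<subseteq> words k n"
proof
  fix w assume "w \<in> set_partitions_at_most n k"
  then obtain Bs where w: "word_of_partition n Bs w" and le: "length Bs \<le> k"
    by (auto simp: set_partitions_at_most_def)
  then have n: "length w = n" by (simp add: word_of_partition_def)
  have "w ! i \<in> {1..k}" if "i < n" for i
    using word_of_partition_letter[OF w that, of "w ! i"] le by auto
  then show "w \<in> words k n"
    using n by (auto simp: words_def in_set_conv_nth)
qed

text \<open>
  Conversely, the two properties suffice for a partition word: its blocks are the sets of positions of the letters, and the order of the first
  occurrences is the order of the block minima.
\<close>

lemma ordered_words_are_partitions:
  assumes ord: "first_occurrences_ordered w" and set: "set w = {1..t}"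
    and n: "length w = n" and "t \<le> k"
  shows "w \<in> set_partitions_at_most n k"
proof -
  define B where "B j = {i \<in> {1..n}. w ! (i - 1) = j}" for j
  define Bs where "Bs = map B [1..<Suc t]"
  have len: "length Bs = t" by (simp add: Bs_def)
  have nth: "Bs ! (j - 1) = B j" if "j \<in> {1..t}" for j
    using that by (auto simp: Bs_def nth_append simp del: upt_Suc)
  have setBs: "set Bs = B ` {1..t}" by (auto simp: Bs_def simp del: upt_Suc)
  have letter: "w ! (i - 1) \<in> {1..t}" if "i \<in> {1..n}" for i
    using that set n nth_mem[of "i - 1" w] by auto
  have fin: "finite (B j)" for j by (simp add: B_def)
  have ne: "B j \<noteq> {}" if "j \<in> {1..t}" for j
  proof -
    obtain i where "i < n" "w ! i = j" using \<open>j \<in> {1..t}\<close> set n by (metis in_set_conv_nth)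
    then have "Suc i \<in> B j" by (simp add: B_def)
    then show ?thesis by blast
  qed
  have "partition_on {1..n} (set Bs)"
    unfolding setBs
  proof (rule partition_onI)
    show "\<Union> (B ` {1..t}) = {1..n}" using letter by (auto simp: B_def)
  next
    show "{} \<notin> B ` {1..t}" using ne by blast
  qed (auto simp: B_def disjnt_def)
  moreover have "sorted_wrt (\<lambda>A B. Min A < Min B) Bs"
    unfolding sorted_wrt_iff_nth_less
  proof (intro allI impI)
    fix i j assume ij: "i < j" "j < length Bs"
    have Bi: "Bs ! i = B (Suc i)" and Bj: "Bs ! j = B (Suc j)"
      using ij len nth[of "Suc i"] nth[of "Suc j"] by auto
    have first: "\<exists>a. Min (B (Suc l)) = Suc a \<and> a < n \<and> w ! a = Suc l" if "l < t" for l
    proof -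
      have "Min (B (Suc l)) \<in> B (Suc l)" using that by (intro Min_in fin ne) simp
      moreover have "\<exists>a. x = Suc a \<and> a < n \<and> w ! a = Suc l" if "x \<in> B (Suc l)" for x
        using that by (cases x) (auto simp: B_def)
      ultimately show ?thesis by blast
    qed
    obtain a where a: "Min (B (Suc i)) = Suc a" "a < n" "w ! a = Suc i"
      using first[of i] ij len by auto
    obtain b where b: "Min (B (Suc j)) = Suc b" "b < n" "w ! b = Suc j"
      using first[of j] ij len by auto
    have "a < b"
    proof (rule ccontr)
      assume "\<not> a < b"
      moreover have "a \<noteq> b" using a b ij by auto
      ultimately have "b < a" by simp
      moreover have "a < length w" "w ! a < w ! b" using a b ij n by auto
      ultimately obtain r where r: "r < a" "w ! r = w ! a"
        using ord unfolding first_occurrences_ordered_def by blast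
      then have "Suc r \<in> B (Suc i)" using a by (simp add: B_def)
      then have "Min (B (Suc i)) \<le> Suc r" using fin by simp
      then show False using r a by simp
    qed
    then show "Min (Bs ! i) < Min (Bs ! j)" by (simp add: Bi Bj a(1) b(1))
  qed
  moreover have "w ! (i - 1) = j \<longleftrightarrow> j \<in> {1..length Bs} \<and> i \<in> Bs ! (j - 1)"
    if "i \<in> {1..n}" for i j
    using that letter[OF that] nth[of j] by (auto simp: len B_def)
  ultimately have "word_of_partition n Bs w"
    using n by (simp add: word_of_partition_def)
  then show ?thesis
    using \<open>t \<le> k\<close> len by (auto simp: set_partitions_at_most_def)
qed

section \<open>Transporting occurrences between words\<close>

lemma nths_eq_map_nth:
  assumes "I \<subseteq> {..<length w}"
  shows "nths w I = map ((!) w) (sorted_list_of_set I)"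
  using assms
proof (induction w arbitrary: I rule: rev_induct)
  case Nil
  then show ?case by simp
next
  case (snoc x w)
  have fin: "finite I" using snoc.prems finite_subset by blast
  let ?J = "I - {length w}"
  have J: "?J \<subseteq> {..<length w}" using snoc.prems by auto
  have "nths w I = nths w ?J"
  proof -
    have "filter (\<lambda>p. snd p \<in> I) (zip w [0..<length w]) =
          filter (\<lambda>p. snd p \<in> ?J) (zip w [0..<length w])"
      by (rule filter_cong) (auto dest: set_zip_rightD)
    then show ?thesis by (simp add: nths_def)
  qed
  also have "\<dots> = map ((!) w) (sorted_list_of_set ?J)" by (rule snoc.IH[OF J])
  also have "\<dots> = map ((!) (w @ [x])) (sorted_list_of_set ?J)"
    using J fin by (auto simp: nth_append)
  finally have w: "nths w I = map ((!) (w @ [x])) (sorted_list_of_set ?J)" .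
  show ?case
  proof (cases "length w \<in> I")
    case True
    have "sorted_list_of_set I = sorted_list_of_set ?J @ [length w]"
    proof (rule sorted_distinct_set_unique)
      show "sorted (sorted_list_of_set ?J @ [length w])"
        using J fin by (auto simp: sorted_append)
    qed (use True fin in auto)
    then show ?thesis using w True by (simp add: nths_append nths_singleton)
  next
    case False
    then show ?thesis using w by (simp add: nths_append nths_singleton)
  qed
qed

lemma sorted_list_of_set_strict_mono_image:
  assumes "finite I" and "strict_mono_on I s"
  shows "sorted_list_of_set (s ` I) = map s (sorted_list_of_set I)"
proof (rule sorted_distinct_set_unique)
  show "sorted (map s (sorted_list_of_set I))"
    using assms
    by (auto simp: sorted_map intro!: sorted_wrt_mono_rel[OF _ sorted_sorted_list_of_set]
        dest: strict_mono_on_leD)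
  show "distinct (map s (sorted_list_of_set I))"
    using assms by (auto simp: distinct_map dest: strict_mono_on_imp_inj_on)
qed (use assms in auto)

definition occurrence_sets :: "nat list set \<Rightarrow> nat list \<Rightarrow> nat set set" where
  "occurrence_sets S w =
     {I. I \<subseteq> {..<length w} \<and> (\<exists>s\<in>S. order_isomorphic (nths w I) s)}"

lemma occurrences_eq_card: "occurrences S w = card (occurrence_sets S w)"
  by (simp add: occurrences_def occurrence_sets_def)

lemma finite_occurrence_sets: "finite (occurrence_sets S w)"
  by (rule finite_subset[of _ "Pow {..<length w}"]) (auto simp: occurrence_sets_def)

lemma occurrence_sets_transport:
  assumes I: "I \<in> occurrence_sets S w" and mono: "strict_mono_on I s"
    and s: "\<And>i. i \<in> I \<Longrightarrow> s i < length v \<and> v ! (s i) = w ! i"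
  shows "s ` I \<in> occurrence_sets S v"
proof -
  have sub: "I \<subseteq> {..<length w}" using I by (simp add: occurrence_sets_def)
  then have fin: "finite I" using finite_subset by blast
  have sub': "s ` I \<subseteq> {..<length v}" using s by auto
  have "nths v (s ` I) = map ((!) v) (map s (sorted_list_of_set I))"
    by (simp add: nths_eq_map_nth[OF sub'] sorted_list_of_set_strict_mono_image[OF fin mono])
  also have "\<dots> = nths w I" using s fin by (simp add: nths_eq_map_nth[OF sub])
  finally show ?thesis using I sub' by (simp add: occurrence_sets_def)
qed

text \<open>
  The hypotheses describe a word \<open>v\<close> that arises from \<open>w\<close> by deleting position \<open>p\<close> and writing
  the letter at \<open>q\<close> twice. The maps \<open>s\<close> and \<open>s'\<close> are the two ways to find the rest of \<open>w\<close> in \<open>v\<close>, sending \<open>q\<close> to one copy or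
  the other. Hence an occurrence that avoids \<open>p\<close> survives once, and once more, with the other
  copy, if it uses \<open>q\<close>.
\<close>

lemma occurrences_clone:
  fixes s s' :: "nat \<Rightarrow> nat"
  assumes len: "length v = length w"
    and mono: "strict_mono_on ({..<length w} - {p}) s" "strict_mono_on ({..<length w} - {p}) s'"
    and copy: "\<And>i. i < length w \<Longrightarrow> i \<noteq> p \<Longrightarrow> s i < length w \<and> v ! (s i) = w ! i"
      "\<And>i. i < length w \<Longrightarrow> i \<noteq> p \<Longrightarrow> s' i < length w \<and> v ! (s' i) = w ! i"
    and agree: "\<And>i. i \<noteq> q \<Longrightarrow> s' i = s i" and differ: "s q \<noteq> s' q"
    and q: "q < length w" "q \<noteq> p"
  shows "card {I \<in> occurrence_sets S w. p \<notin> I} + card {I \<in> occurrence_sets S w. p \<notin> I \<and> q \<in> I}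
           \<le> occurrences S v"
proof -
  let ?D = "{..<length w} - {p}"
  let ?A = "{I \<in> occurrence_sets S w. p \<notin> I}"
  let ?Q = "{I \<in> occurrence_sets S w. p \<notin> I \<and> q \<in> I}"
  have inj: "inj_on s ?D" "inj_on s' ?D" using mono strict_mono_on_imp_inj_on by blast+
  have sub: "I \<subseteq> ?D" if "I \<in> ?A" for I using that by (auto simp: occurrence_sets_def)
  have tr: "s ` I \<in> occurrence_sets S v" "s' ` I \<in> occurrence_sets S v" if "I \<in> ?A" for I
  proof -
    have "strict_mono_on I s" "strict_mono_on I s'"
      using mono sub[OF that] monotone_on_subset by blast+
    moreover have "i < length w \<and> i \<noteq> p" if "i \<in> I" for i
      using sub[OF \<open>I \<in> ?A\<close>] that by blast
    ultimately show "s ` I \<in> occurrence_sets S v" "s' ` I \<in> occurrence_sets S v"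
      using \<open>I \<in> ?A\<close> copy len by (auto intro!: occurrence_sets_transport[of I S w])
  qed
  have inj_image: "inj_on ((`) s) ?A" "inj_on ((`) s') ?Q"
    using sub inj by (auto intro!: inj_onI simp: inj_on_image_eq_iff)
  (* s' q is the second copy of the letter at q, and s maps no position other than p to it. *)
  have disj: "(`) s ` ?A \<inter> (`) s' ` ?Q = {}"
  proof -
    have "s' q \<notin> s ` I" if "I \<in> ?A" for I
    proof
      assume "s' q \<in> s ` I"
      then obtain i where i: "i \<in> I" "s' q = s i" by blast
      then have "i \<noteq> q" using differ by auto
      then have "s' q = s' i" using i agree by simp
      then show False using inj(2) i sub[OF that] q \<open>i \<noteq> q\<close> by (auto dest: inj_onD)
    qed
    then show ?thesis by blast
  qed
  have "card ?A + card ?Q = card ((`) s ` ?A \<union> (`) s' ` ?Q)"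
    using finite_occurrence_sets[of S w] disj
    by (simp add: card_Un_disjoint card_image[OF inj_image(1)] card_image[OF inj_image(2)])
  also have "\<dots> \<le> card (occurrence_sets S v)"
    using tr by (intro card_mono finite_occurrence_sets) auto
  finally show ?thesis by (simp add: occurrences_eq_card)
qed

section \<open>Maximizers with the least sum of letters\<close>

text \<open>
  If an occurrence used both positions, the pattern would have a descent at the corresponding
  entries, and so an earlier entry equal to the smaller one. This corresponds to a position of
  the letter \<open>w ! q\<close> before its first occurrence \<open>q\<close>.
\<close>

lemma no_occurrence_contains_both:
  assumes S: "\<And>s. s \<in> S \<Longrightarrow> first_occurrences_ordered s"
    and I: "I \<in> occurrence_sets S w"
    and pq: "p < q" "w ! q < w ! p" and first: "\<And>r. r < q \<Longrightarrow> w ! r \<noteq> w ! q"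
  shows "\<not> (p \<in> I \<and> q \<in> I)"
proof
  assume both: "p \<in> I \<and> q \<in> I"
  obtain s where s: "s \<in> S" "order_isomorphic (nths w I) s" and sub: "I \<subseteq> {..<length w}"
    using I by (auto simp: occurrence_sets_def)
  let ?l = "sorted_list_of_set I"
  have fin: "finite I" using sub finite_subset by blast
  have nths: "nths w I = map ((!) w) ?l" by (rule nths_eq_map_nth[OF sub])
  have len: "length s = length ?l" using s nths by (simp add: order_isomorphic_def)
  have mono: "?l ! i < ?l ! j \<longleftrightarrow> i < j" if "i < length ?l" "j < length ?l" for i j
    using that sorted_wrt_nth_less[OF strict_sorted_list_of_set[of I]]
    by (metis less_asym linorder_neqE_nat less_irrefl)
  obtain i j where i: "i < length ?l" "?l ! i = p" and j: "j < length ?l" "?l ! j = q"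
    using both fin by (metis in_set_conv_nth set_sorted_list_of_set)
  have "i < j" using mono[OF i(1) j(1)] i j pq by simp
  moreover have iso: "\<forall>a<length ?l. \<forall>b<length ?l. a \<noteq> b \<longrightarrow>
      (w ! (?l ! a) = w ! (?l ! b) \<longleftrightarrow> s ! a = s ! b) \<and>
      (w ! (?l ! a) < w ! (?l ! b) \<longleftrightarrow> s ! a < s ! b)"
    using s(2) by (simp add: order_isomorphic_def nths)
  then have "s ! j < s ! i" using i j pq \<open>i < j\<close> by (metis less_irrefl)
  ultimately obtain r where r: "r < j" "s ! r = s ! j"
    using S[OF s(1)] j len unfolding first_occurrences_ordered_def by metis
  then have "w ! (?l ! r) = w ! q" using iso j by (metis less_trans less_irrefl)
  moreover have "?l ! r < q" using mono[of r j] r j by simp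
  ultimately show False using first by blast
qed

text \<open>
  By maximality the occurrences that use \<open>p\<close> are as many as those that use \<open>q\<close>, so replacing the
  larger letter at \<open>p\<close> by a second copy of the smaller letter at \<open>q\<close> costs nothing. The copy is
  placed next to \<open>q\<close> and not at \<open>p\<close>, because there it can stand in for \<open>q\<close> in every
  occurrence that avoids \<open>p\<close>.
\<close>

lemma symmetrization:
  assumes S: "\<And>s. s \<in> S \<Longrightarrow> first_occurrences_ordered s"
    and w: "w \<in> words k n"
    and max: "\<And>v. v \<in> words k n \<Longrightarrow> occurrences S v \<le> occurrences S w"
    and pq: "p < q" "q < n" "w ! q < w ! p" and first: "\<And>r. r < q \<Longrightarrow> w ! r \<noteq> w ! q"
  shows "\<exists>v \<in> words k n. occurrences S v = occurrences S w \<and> sum_list v < sum_list w"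
proof -
  have n: "length w = n" and set: "set w \<subseteq> {1..k}" using w by (auto simp: words_def)
  (* The new words are read off w along monotone maps of the positions: g skips p and hits q
     twice, at q - 1 and q, while h skips q and hits p twice, at p and p + 1. *)
  define g h where "g i = (if p \<le> i \<and> i < q then Suc i else i)"
    and "h i = (if p < i \<and> i \<le> q then i - 1 else i)" for i
  define v u where "v = map (\<lambda>i. w ! g i) [0..<n]" and "u = map (\<lambda>i. w ! h i) [0..<n]"
  have gh: "g i < n" "h i < n" if "i < n" for i
    using that pq by (auto simp: g_def h_def)
  have vu: "v \<in> words k n" "u \<in> words k n"
    using gh set n by (auto simp: v_def u_def words_def subset_iff)
  let ?O = "occurrence_sets S w"
  let ?None = "{I \<in> ?O. p \<notin> I \<and> q \<notin> I}"
  let ?P = "{I \<in> ?O. q \<notin> I \<and> p \<in> I}"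
  let ?Q = "{I \<in> ?O. p \<notin> I \<and> q \<in> I}"
  note fin = finite_occurrence_sets[of S w]
  have v: "card {I \<in> ?O. p \<notin> I} + card ?Q \<le> occurrences S v"
    by (rule occurrences_clone[where s = "\<lambda>i. if p < i \<and> i < q then i - 1 else i"
          and s' = "\<lambda>i. if p < i \<and> i \<le> q then i - 1 else i"])
      (use pq n in \<open>auto simp: v_def g_def strict_mono_on_def\<close>)
  have u: "card {I \<in> ?O. q \<notin> I} + card ?P \<le> occurrences S u"
    by (rule occurrences_clone[where s = "\<lambda>i. if p < i \<and> i < q then i + 1 else i"
          and s' = "\<lambda>i. if p \<le> i \<and> i < q then i + 1 else i"])
      (use pq n in \<open>auto simp: u_def h_def strict_mono_on_def\<close>)
  have splitp: "card {I \<in> ?O. p \<notin> I} = card ?None + card ?Q"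
    using fin by (subst card_Un_disjoint[symmetric]) (auto intro!: arg_cong[where f = card])
  have splitq: "card {I \<in> ?O. q \<notin> I} = card ?None + card ?P"
    using fin by (subst card_Un_disjoint[symmetric]) (auto intro!: arg_cong[where f = card])
  have "?O = {I \<in> ?O. p \<notin> I} \<union> ?P"
    using no_occurrence_contains_both[OF S _ pq(1,3) first] by blast
  then have "card ?O = card {I \<in> ?O. p \<notin> I} + card ?P"
    using fin card_Un_disjoint[of "{I \<in> ?O. p \<notin> I}" ?P] by auto
  then have "occurrences S w = card ?None + card ?P + card ?Q"
    using splitp by (simp add: occurrences_eq_card)
  then have "occurrences S v = occurrences S w"
    using u v splitp splitq max[OF vu(1)] max[OF vu(2)] by linarith
  moreover have "sum_list v < sum_list w"
  proof -
    have "(\<Sum>i\<in>{..<n} - {q - 1}. w ! g i) = (\<Sum>i\<in>{..<n} - {p}. w ! i)"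
      by (rule sum.reindex_bij_witness[where i = "\<lambda>i. if p < i \<and> i < q then i - 1 else i" and j = g])
        (use pq in \<open>auto simp: g_def split: if_splits\<close>)
    moreover have "sum_list v = (\<Sum>i<n. w ! g i)"
      by (simp add: v_def sum_list_sum_nth atLeast0LessThan)
    moreover have "g (q - 1) = q" using pq by (auto simp: g_def)
    then have "(\<Sum>i<n. w ! g i) = w ! q + (\<Sum>i\<in>{..<n} - {q - 1}. w ! g i)"
      using sum.remove[of "{..<n}" "q - 1" "\<lambda>i. w ! g i"] pq by simp
    moreover have "sum_list w = w ! p + (\<Sum>i\<in>{..<n} - {p}. w ! i)"
      using sum.remove[of "{..<n}" p "(!) w"] pq n
      by (simp add: sum_list_sum_nth atLeast0LessThan)
    ultimately have "sum_list v + w ! p = sum_list w + w ! q" by simp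
    then show ?thesis using pq by linarith
  qed
  ultimately show ?thesis using vu by blast
qed

text \<open>
  Lowering all letters above the missing letter \<open>a\<close> by one is strictly increasing on the letters
  of \<open>w\<close>, hence invisible to order isomorphism.
\<close>

lemma compress_gap:
  assumes w: "w \<in> words k n" and a: "a \<ge> 1" "a \<notin> set w" and b: "b \<in> set w" "a < b"
  shows "\<exists>v \<in> words k n. occurrences S v = occurrences S w \<and> sum_list v < sum_list w"
proof -
  define f where "f x = (if a < x then x - 1 else x)" for x :: nat
  have f: "(f x = f y \<longleftrightarrow> x = y) \<and> (f x < f y \<longleftrightarrow> x < y)" if "x \<noteq> a" "y \<noteq> a" for x y
    using that by (auto simp: f_def)
  have "order_isomorphic (nths (map f w) I) s \<longleftrightarrow> order_isomorphic (nths w I) s" for I s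
  proof -
    have "nths w I ! i \<noteq> a" if "i < length (nths w I)" for i
      using that a set_nths_subset[of w I] nth_mem by blast
    then show ?thesis using f by (auto simp: order_isomorphic_def nths_map)
  qed
  then have "occurrences S (map f w) = occurrences S w" by (simp add: occurrences_def)
  moreover have "map f w \<in> words k n" using w a by (force simp: words_def f_def)
  moreover have "sum_list (map f w) < sum_list w"
  proof -
    obtain xs ys where "w = xs @ b # ys" using b split_list by fast
    moreover have "sum_list (map f zs) \<le> sum_list zs" for zs
      by (induction zs) (auto simp: f_def)
    note this[of xs] this[of ys]
    moreover have "f b < b" using b a by (simp add: f_def)
    ultimately show ?thesis by simp
  qed
  ultimately show ?thesis by blast
qed

lemma finite_words: "finite (words k n)"
  using finite_lists_length_eq[of "{1..k}" n] by (simp add: words_def)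

lemma maximum_attained_by_partition:
  assumes S: "\<And>s. s \<in> S \<Longrightarrow> first_occurrences_ordered s"
    and ne: "words k n \<noteq> {}"
  shows "\<exists>w \<in> set_partitions_at_most n k. \<forall>v \<in> words k n. occurrences S v \<le> occurrences S w"
proof -
  define M where "M = {w \<in> words k n. \<forall>v \<in> words k n. occurrences S v \<le> occurrences S w}"
  obtain w0 where "w0 \<in> M"
    using finite_words[of k n] ne Max_in[of "occurrences S ` words k n"]
      Max_ge[of "occurrences S ` words k n"] by (fastforce simp: M_def)
  then obtain w where w: "w \<in> M" and min: "\<And>v. v \<in> M \<Longrightarrow> sum_list w \<le> sum_list v"
    using ex_has_least_nat[of "\<lambda>w. w \<in> M" w0 sum_list] by blast
  have wk: "w \<in> words k n" and max: "\<And>v. v \<in> words k n \<Longrightarrow> occurrences S v \<le> occurrences S w"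
    using w by (auto simp: M_def)
  have irreducible: "\<not> (\<exists>v \<in> words k n. occurrences S v = occurrences S w \<and> sum_list v < sum_list w)"
    using min max by (force simp: M_def)
  have n: "length w = n" and set: "set w \<subseteq> {1..k}" using wk by (auto simp: words_def)
  have "first_occurrences_ordered w"
    using symmetrization[OF S wk max] irreducible n
    unfolding first_occurrences_ordered_def by blast
  moreover have "\<exists>t\<le>k. set w = {1..t}"
  proof (cases "w = []")
    case True
    then show ?thesis by (intro exI[of _ 0]) simp
  next
    case False
    then have t: "Max (set w) \<in> set w" by simp
    have "a \<in> set w" if "1 \<le> a" "a \<le> Max (set w)" for a
      using compress_gap[OF wk _ _ t] irreducible that t by (metis le_neq_implies_less)
    then have "set w = {1..Max (set w)}" using set by auto
    then show ?thesis using t set by (intro exI[of _ "Max (set w)"]) auto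
  qed
  ultimately have "w \<in> set_partitions_at_most n k"
    using ordered_words_are_partitions n by blast
  then show ?thesis using max by blast
qed

theorem proposition1p1:
  fixes m n k :: nat and S :: "nat list set"
  assumes "m \<ge> 1" and "S \<subseteq> set_partitions m" and "n \<ge> m" and "k \<ge> 1"
  shows "delta_restricted m S n k = delta_hat m S n k"
proof -
  have S: "\<And>s. s \<in> S \<Longrightarrow> first_occurrences_ordered s"
    using assms(2) set_partitions_first_occurrences_ordered by blast
  have "replicate n 1 \<in> words k n" using \<open>k \<ge> 1\<close> by (auto simp: words_def)
  then obtain w where w: "w \<in> set_partitions_at_most n k"
    and max: "\<forall>v \<in> words k n. occurrences S v \<le> occurrences S w"
    using maximum_attained_by_partition[OF S] by blast
  have sub: "set_partitions_at_most n k \<subseteq> words k n"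
    by (rule set_partitions_at_most_subset_words)
  then have "Max (occurrences S ` words k n) = occurrences S w"
    using w max by (intro Max_eqI) (auto simp: finite_words)
  moreover have "Max (occurrences S ` set_partitions_at_most n k) = occurrences S w"
    using w max sub finite_subset[OF sub finite_words] by (intro Max_eqI) auto
  ultimately show ?thesis by (simp add: delta_restricted_def delta_hat_def)
qed

end
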